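(* For any integer $g\ge 3$ there exists a constant $c<1$ such that $$\bigl|\{n\le x:\ n=p_1+p_2,\ p_1 \text{ and } p_2 \text{ are base } g \text{ palindromes}\}\bigr|\le cx$$ for all sufficiently large $x$.
   Context: Here $n$ ranges over positive integers. Every nonnegative integer has a unique base $g$ representation $\delta_{l-1}\cdots\delta_0$ with digits $0\le \delta_j\le g-1$ and $\delta_{l-1}\ne 0$; it is a base $g$ palindrome if $\delta_{l-i}=\delta_{i-1}$ for all $i=1,\dots,\lfloor l/2\rfloor$. By convention $0$ is also considered a base $g$ palindrome. *)

theory Defs
  imports Complex_Main
begin

text \<open>
  \<open>base_repr g n ds\<close>: the digit list \<open>ds\<close> is the base \<open>g\<close> representation of \<open>n\<close>,
  least significant digit first, so that \<open>ds ! j\<close> is the coefficient of \<open>g ^ j\<close>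
  and \<open>last ds\<close> is the leading digit. The leading digit must be nonzero, which forces \<open>n > 0\<close>
  since \<open>ds\<close> is nonempty; zero is handled by convention below.
\<close>

definition base_repr :: "nat \<Rightarrow> nat \<Rightarrow> nat list \<Rightarrow> bool" where
  "base_repr g n ds \<longleftrightarrow>
     ds \<noteq> [] \<and> last ds \<noteq> 0 \<and> (\<forall>j<length ds. ds ! j \<le> g - 1) \<and>
     n = (\<Sum>j<length ds. ds ! j * g ^ j)"

definition palindrome :: "nat \<Rightarrow> nat \<Rightarrow> bool" where
  "palindrome g n \<longleftrightarrow>
     n = 0 \<or>
     (\<exists>ds. base_repr g n ds \<and>
        (\<forall>i\<in>{1..length ds div 2}. ds ! (length ds - i) = ds ! (i - 1)))"

end

(*
The obstruction is local. A nonzero palindrome repeats its two leading digits, reversed, as its two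
trailing digits, so prescribing both ends of n constrains p1 + p2 twice. Take n with leading digits
2, 2 and trailing digits 0, 2. The longer summand must have the length of n. If the other one is
shorter and nonzero, the last digit of n forces both leading digits to be 1, and then the sum is too
small; if it has equal length, both leading digits are 1 and the second digits add up to a multiple
of g that is at most 2 < g, so they vanish and again the sum is too small; if it is zero, n itself
would be a palindrome. Such n have positive lower density.
*)
theory Submission
  imports Defs
begin

section \<open>Both ends of a palindrome as inequalities and residues\<close>

lemma digit_sum_less:
  fixes g :: nat
  assumes "g \<ge> 1" "\<forall>j<k. d j \<le> g - 1"
  shows "(\<Sum>j<k. d j * g ^ j) < g ^ k"
  using assms(2)
proof (induction k)
  case 0
  then show ?case by simp
next
  case (Suc k)
  have "(\<Sum>j<k. d j * g ^ j) < g ^ k"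
    using Suc by simp
  moreover have "d k * g ^ k \<le> (g - 1) * g ^ k"
    using Suc.prems by (intro mult_right_mono) auto
  moreover have "g ^ k + (g - 1) * g ^ k = g ^ Suc k"
    using assms(1) by (cases g) auto
  ultimately show ?case unfolding sum.lessThan_Suc by linarith
qed

text \<open>Here \<open>m\<close> is the position of the leading digit, one less than the number of
  digits, and \<open>b\<close> is the second digit from either end. Leading digits are recorded as
  intervals and trailing ones as residues, so that sums of palindromes can be handled without
  tracking carries.\<close>

definition pal_ends :: "nat \<Rightarrow> nat \<Rightarrow> nat \<Rightarrow> nat \<Rightarrow> bool" where
  "pal_ends g p m a \<longleftrightarrow>
     1 \<le> a \<and> a < g \<and> p mod g = a \<and> a * g ^ m \<le> p \<and> p < Suc a * g ^ m \<and>
     (m \<ge> 1 \<longrightarrow> (\<exists>b<g. p mod g ^ 2 = a + b * g \<and>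
        a * g ^ m + b * g ^ (m - 1) \<le> p \<and> p < a * g ^ m + Suc b * g ^ (m - 1)))"

text \<open>Splitting the digit sum from below gives the residues; splitting it from above gives the
  intervals, since by \<open>digit_sum_less\<close> the remaining digits contribute less than the
  next power of \<open>g\<close>. Symmetry enters only for \<open>i = 1\<close> and
  \<open>i = 2\<close>.\<close>

lemma palindrome_pal_ends:
  assumes g: "g \<ge> 2" and pal: "palindrome g p" and p: "p \<noteq> 0"
  obtains m a where "pal_ends g p m a"
proof -
  obtain ds where ds: "ds \<noteq> []" "last ds \<noteq> 0" "\<forall>j<length ds. ds ! j \<le> g - 1"
    "p = (\<Sum>j<length ds. ds ! j * g ^ j)"
    and sym: "\<forall>i\<in>{1..length ds div 2}. ds ! (length ds - i) = ds ! (i - 1)"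
    using pal p unfolding palindrome_def base_repr_def by blast
  define d where "d = (\<lambda>j. ds ! j)"
  define m where "m = length ds - 1"
  have len: "length ds = Suc m" using ds(1) by (cases ds) (auto simp: m_def)
  have dle: "\<forall>j<Suc m. d j \<le> g - 1" using ds(3) len by (simp add: d_def)
  have pd: "p = (\<Sum>j<Suc m. d j * g ^ j)" using ds(4) len by (simp add: d_def)
  have dm: "1 \<le> d m" using ds(1,2) by (simp add: d_def m_def last_conv_nth)
  have dmg: "d m < g" using dle g by (auto simp: less_Suc_eq_le dest!: spec[of _ m])
  have d0: "d 0 = d m"
    using sym[rule_format, of 1] len by (cases "m = 0") (auto simp: d_def)
  have low: "(\<Sum>j<m. d j * g ^ j) < g ^ m"
    using digit_sum_less[of g m d] dle g by auto
  have p1: "p = d 0 + g * (\<Sum>j<m. d (Suc j) * g ^ j)"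
    unfolding pd sum.lessThan_Suc_shift by (simp add: sum_distrib_left mult_ac)
  have snd: "\<exists>b<g. p mod g ^ 2 = d m + b * g \<and>
        d m * g ^ m + b * g ^ (m - 1) \<le> p \<and> p < d m * g ^ m + Suc b * g ^ (m - 1)"
    if "m \<ge> 1"
  proof -
    obtain k where k: "m = Suc k" using \<open>m \<ge> 1\<close> by (cases m) auto
    \<comment> \<open>Symmetry at \<open>i = 2\<close> needs at least four digits. With three digits
      both sides are the middle digit; with two the claim is \<open>d0\<close> again.\<close>
    have d1: "d 1 = d k"
    proof (cases "k \<ge> 2")
      case True
      then show ?thesis using sym[rule_format, of 2] len k
        by (simp add: d_def)
    next
      case False
      then have "k = 0 \<or> k = 1" by auto
      then show ?thesis using d0 k by auto
    qed
    have kg: "d k < g" using dle g k by (auto dest!: spec[of _ k])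
    have lowk: "(\<Sum>j<k. d j * g ^ j) < g ^ k"
      using digit_sum_less[of g k d] dle g k by auto
    have "p = d 0 + g * d 1 + g ^ 2 * (\<Sum>j<k. d (Suc (Suc j)) * g ^ j)"
      unfolding p1 k sum.lessThan_Suc_shift
      by (simp add: sum_distrib_left mult_ac power2_eq_square distrib_left)
    moreover have "d 0 + g * d 1 < g ^ 2"
    proof -
      have "g * (d k + 1) \<le> g * g" using kg by (intro mult_left_mono) auto
      then show ?thesis using d0 dmg d1 by (simp add: power2_eq_square)
    qed
    ultimately have "p mod g ^ 2 = d m + d k * g"
      using d0 d1 by (simp add: mult.commute)
    moreover have "p = d m * g ^ m + d k * g ^ k + (\<Sum>j<k. d j * g ^ j)"
      using pd k by simp
    ultimately show ?thesis
      using kg lowk k by (intro exI[of _ "d k"]) simp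
  qed
  have "pal_ends g p m (d m)"
    unfolding pal_ends_def using dm dmg snd low d0 p1 pd by simp
  then show ?thesis using that by blast
qed

lemma pal_ends_less_power:
  assumes "pal_ends g p m a" "m < M"
  shows "p < g ^ M"
proof -
  have "p < Suc a * g ^ m" using assms(1) by (simp add: pal_ends_def)
  also have "\<dots> \<le> g * g ^ m"
    using assms(1) by (intro mult_right_mono) (auto simp: pal_ends_def)
  also have "\<dots> \<le> g ^ M"
    using assms by (auto simp flip: power_Suc intro!: power_increasing simp: pal_ends_def)
  finally show ?thesis .
qed

section \<open>Integers with leading digits 2, 2 and trailing digits 0, 2\<close>

lemma no_sum_long_summand:
  assumes g: "g \<ge> 3" and M: "M \<ge> 1"
    and lo: "2 * g ^ M + 2 * g ^ (M - 1) \<le> n" and hi: "n < 2 * g ^ M + 3 * g ^ (M - 1)"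
    and md: "n mod g ^ 2 = 2"
    and n: "n = p + q" and p: "pal_ends g p M a" and q: "palindrome g q"
  shows False
proof -
  obtain M' where M': "M = Suc M'" using M by (cases M) auto
  define G where "G = g ^ M'"
  have G: "G > 0" "g ^ (M - 1) = G" "g ^ M = g * G" using g M' by (auto simp: G_def)
  have gG: "3 * G \<le> g * G" using g by simp
  have a: "1 \<le> a" "a < g" "p mod g = a" "a * (g * G) \<le> p" "p < Suc a * (g * G)"
    using p G by (auto simp: pal_ends_def)
  obtain b where b: "b < g" "p mod g ^ 2 = a + b * g"
    "a * (g * G) + b * G \<le> p" "p < a * (g * G) + Suc b * G"
    using p G M by (auto simp: pal_ends_def)
  have lo': "2 * (g * G) + 2 * G \<le> n" and hi': "n < 2 * (g * G) + 3 * G"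
    using lo hi G by auto
  have "n mod g = n mod g ^ 2 mod g"
    by (simp add: mod_mod_cancel power2_eq_square)
  then have mdg: "(p + q) mod g = 2" using md g n by simp
  have "n < 3 * (g * G)" using hi' gG by linarith
  then have n_lt: "n < Suc 2 * (g * G)" by simp
  have digit_le: "c < Suc d" if "c * X \<le> n" "n < Suc d * X" for c d X
    using that by (metis le_less_trans mult_less_cancel2)
  consider "q = 0" | m c where "pal_ends g q m c"
    using palindrome_pal_ends[OF _ q] g by force
  then show False
  proof cases
    case 1
    have "a = 2" using a(2,3) mdg 1 by simp
    \<comment> \<open>The residue \<open>a + b * g\<close> must be 2, while the interval for
      \<open>n\<close> asks for second digit 2.\<close>
    then have "b = 0" using b(2) md n 1 g by auto
    then show False using b(4) \<open>a = 2\<close> lo' n 1 G by simp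
  next
    case (2 m c)
    have c: "1 \<le> c" "c < g" "q mod g = c" "c * g ^ m \<le> q" "q < Suc c * g ^ m"
      using 2 by (auto simp: pal_ends_def)
    have ac: "(a + c) mod g = 2" using mdg a(3) c(3) by (metis mod_add_eq)
    have a2: "a \<le> 2"
      using digit_le[OF _ n_lt, of a] a(4) n by simp
    have "m < Suc M"
    proof -
      have "g ^ m \<le> 1 * g ^ m" by simp
      also have "\<dots> \<le> c * g ^ m" using c by (intro mult_right_mono) auto
      also have "\<dots> \<le> n" using c n by simp
      also have "\<dots> < 3 * (g * G)" using n_lt by simp
      also have "\<dots> \<le> g ^ Suc M" using G g by simp
      finally show ?thesis using g power_less_imp_less_exp[of g m "Suc M"] by simp
    qed
    then consider "m < M" | "m = M" by linarith
    then show False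
    proof cases
      case 1
      have "a = 1" "c = 1"
      proof -
        have "a = 1 \<or> a = 2" using a(1) a2 by auto
        \<comment> \<open>Otherwise \<open>g\<close> would divide \<open>c\<close>, which lies
          strictly between 0 and \<open>g\<close>.\<close>
        moreover have "a \<noteq> 2"
        proof
          assume "a = 2"
          then have "(2 + c) mod g = 2" using ac by simp
          then show False using c(1,2) g
            by (cases "2 + c < g") (auto simp: le_mod_geq)
        qed
        ultimately show "a = 1" by blast
        then have "(1 + c) mod g = 2" using ac by simp
        then show "c = 1" using c(1,2) g
          by (cases "1 + c < g") (auto simp: le_mod_geq)
      qed
      have "g ^ m \<le> G" unfolding G_def using 1 M' g by (intro power_increasing) auto
      then have "q < 2 * G" using c(5) \<open>c = 1\<close> by simp
      \<comment> \<open>Now \<open>p < 2 * g ^ M\<close> and \<open>q < 2 * g ^ (M - 1)\<close>, so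
        \<open>n\<close> falls short of its lower bound.\<close>
      then show False using a(5) \<open>a = 1\<close> n lo' by simp
    next
      case 2
      note m = 2
      obtain e where e: "e < g" "q mod g ^ 2 = c + e * g"
        "c * (g * G) + e * G \<le> q" "q < c * (g * G) + Suc e * G"
        using \<open>pal_ends g q m c\<close> G M m by (auto simp: pal_ends_def)
      have "(a + c) * (g * G) \<le> n"
        using a(4) e(3) n unfolding distrib_right by linarith
      then have "a + c < Suc 2" using digit_le n_lt by blast
      then have ac1: "a = 1" "c = 1" using a c by auto
      have "(b + e) * G < 3 * G"
        using b(3) e(3) ac1 n hi' by (simp add: algebra_simps)
      then have be: "b + e < 3" using G by simp
      have "(p + q) mod g ^ 2 = (2 + (b + e) * g) mod g ^ 2"
        using b(2) e(2) ac1 mod_add_eq[of p "g ^ 2" q] by (simp add: algebra_simps)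
      \<comment> \<open>As \<open>b + e + 1 \<le> 3 \<le> g\<close> and \<open>2 < g\<close>, there
        is no reduction modulo \<open>g ^ 2\<close>, and the residue determines
        \<open>b + e\<close>.\<close>
      moreover have "2 + (b + e) * g < g ^ 2"
      proof -
        have "(b + e + 1) * g \<le> g * g" using be g by (intro mult_right_mono) auto
        then show ?thesis using g by (simp add: power2_eq_square algebra_simps)
      qed
      ultimately have "(b + e) * g = 0" using md n by simp
      then have "b = 0" "e = 0" using g by auto
      \<comment> \<open>Both summands are below \<open>g ^ M + g ^ (M - 1)\<close>; twice this is
        exactly the lower bound on \<open>n\<close>.\<close>
      then show False using b(4) e(4) ac1 n lo' by simp
    qed
  qed
qed

text \<open>If neither summand has its leading digit at position \<open>M\<close>, both are below
  \<open>g ^ M\<close> and their sum is below \<open>2 * g ^ M\<close>. Otherwise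
  \<open>no_sum_long_summand\<close> applies, possibly with the summands exchanged.\<close>

lemma no_palindrome_sum:
  assumes g: "g \<ge> 3" and M: "M \<ge> 1"
    and lo: "2 * g ^ M + 2 * g ^ (M - 1) \<le> n" and hi: "n < 2 * g ^ M + 3 * g ^ (M - 1)"
    and md: "n mod g ^ 2 = 2"
    and n: "n = p + q" and p: "palindrome g p" and q: "palindrome g q"
  shows False
proof -
  have nlt: "n < g ^ Suc M"
  proof -
    have "3 * g ^ (M - 1) \<le> g ^ M" using g M by (cases M) auto
    then have "n < 3 * g ^ M" using hi by linarith
    also have "\<dots> \<le> g ^ Suc M" using g by simp
    finally show ?thesis .
  qed
  have small: "r < g ^ M"
    if r: "palindrome g r" "r \<le> n" and no: "\<And>a. \<not> pal_ends g r M a" for r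
  proof (cases "r = 0")
    case False
    then obtain m a where ma: "pal_ends g r m a"
      using palindrome_pal_ends[of g r] g r by auto
    have "1 * g ^ m \<le> a * g ^ m" using ma by (intro mult_right_mono) (auto simp: pal_ends_def)
    also have "\<dots> \<le> r" using ma by (simp add: pal_ends_def)
    also have "\<dots> < g ^ Suc M" using r(2) nlt by simp
    finally have "m < Suc M" using g power_less_imp_less_exp[of g m "Suc M"] by simp
    moreover have "m \<noteq> M" using no ma by auto
    ultimately show ?thesis using pal_ends_less_power[OF ma] by simp
  qed (use g in simp)
  have "\<not> pal_ends g p M a" for a
    using no_sum_long_summand[OF g M lo hi md n _ q] by blast
  moreover have "\<not> pal_ends g q M a" for a
    using no_sum_long_summand[OF g M lo hi md _ _ p] n by (metis add.commute)
  ultimately have "p < g ^ M" "q < g ^ M" using small p q n by auto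
  then show False using lo n by simp
qed

section \<open>Counting the exceptional integers up to x\<close>

theorem theorem1p3:
  fixes g :: nat
  assumes "g \<ge> 3"
  shows "\<exists>c::real. c < 1 \<and>
    (\<forall>\<^sub>F x::real in at_top.
       real (card {n::nat. n \<ge> 1 \<and> real n \<le> x \<and>
         (\<exists>p1 p2. n = p1 + p2 \<and> palindrome g p1 \<and> palindrome g p2)}) \<le> c * x)"
proof (intro exI conjI)
  \<comment> \<open>With \<open>3 * g ^ M \<le> x < 3 * g ^ (M + 1)\<close>, there are
    \<open>g ^ (M - 3)\<close> exceptions up to \<open>x\<close>, more than
    \<open>x / (3 * g ^ 4)\<close>.\<close>
  show "1 - 1 / (3 * real g ^ 4) < 1" using assms by simp
  show "\<forall>\<^sub>F x::real in at_top.
       real (card {n::nat. n \<ge> 1 \<and> real n \<le> x \<and>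
         (\<exists>p1 p2. n = p1 + p2 \<and> palindrome g p1 \<and> palindrome g p2)})
       \<le> (1 - 1 / (3 * real g ^ 4)) * x"
    \<comment> \<open>This threshold guarantees \<open>M \<ge> 3\<close>, so that
      \<open>g ^ (M - 3)\<close> makes sense.\<close>
    using eventually_ge_at_top[of "3 * real g ^ 3"]
  proof eventually_elim
    case (elim x)
    \<comment> \<open>Dividing by 3 leaves room for all exceptions: they are below
      \<open>2 * g ^ M + 3 * g ^ (M - 1) \<le> 3 * g ^ M\<close>.\<close>
    define N where "N = nat \<lfloor>x / 3\<rfloor>"
    have x3: "real g ^ 3 \<le> x / 3" using elim by simp
    have x0: "x \<ge> 0" using elim by (rule order_trans[rotated]) simp
    have gN: "g ^ 3 \<le> N" unfolding N_def using x3 by (simp add: le_nat_floor)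
    moreover have "1 \<le> g ^ 3" using assms by simp
    ultimately have "1 \<le> N" "2 \<le> g" using assms by linarith+
    then obtain M where M: "g ^ M \<le> N" "N < g ^ (M + 1)"
      using ex_power_ivl1 by blast
    have "g ^ 3 < g ^ (M + 1)" using gN M by linarith
    then have "3 < M + 1" using assms power_less_imp_less_exp[of g 3 "M + 1"] by simp
    then obtain k where k: "M = k + 3" using le_Suc_ex[of 3 M] by (auto simp: add.commute)
    have x_lo: "3 * real g ^ M \<le> x"
    proof -
      have "real g ^ M \<le> real N" using M(1) by (metis of_nat_le_iff of_nat_power)
      also have "\<dots> \<le> x / 3" unfolding N_def using x0 by (intro of_nat_floor) simp
      finally show ?thesis by simp
    qed
    have x_hi: "x < 3 * real g ^ (M + 1)"
    proof -
      have "x / 3 < real N + 1" unfolding N_def using x0 by linarith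
      also have "real N + 1 \<le> real g ^ (M + 1)"
        using M(2) by (metis Suc_leI of_nat_Suc of_nat_le_iff of_nat_power add.commute)
      finally show ?thesis by simp
    qed
    have g2: "2 < g ^ 2"
      using assms mult_mono[of 3 g 3 g] by (simp add: power2_eq_square)
    \<comment> \<open>The two leading digits and the last two are fixed; \<open>t\<close> runs
      through the \<open>k = M - 3\<close> free digits between them.\<close>
    define f where "f = (\<lambda>t. 2 * g ^ M + 2 * g ^ (M - 1) + (g ^ 2 * t + 2))"
    define B where "B = f ` {..<g ^ k}"
    let ?A = "{n::nat. n \<ge> 1 \<and> real n \<le> x \<and>
         (\<exists>p1 p2. n = p1 + p2 \<and> palindrome g p1 \<and> palindrome g p2)}"
    have f_hi: "f t < 2 * g ^ M + 3 * g ^ (M - 1)" if "t < g ^ k" for t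
    proof -
      have "g ^ 2 * (t + 1) \<le> g ^ 2 * g ^ k" using that by (intro mult_left_mono) auto
      also have "\<dots> = g ^ (M - 1)" using k by (simp flip: power_add)
      finally have "g ^ 2 * t + g ^ 2 \<le> g ^ (M - 1)" by (simp add: algebra_simps)
      then show ?thesis unfolding f_def using g2 by linarith
    qed
    have f_mod: "f t mod g ^ 2 = 2" for t
    proof -
      have "f t = 2 + g ^ 2 * (2 * g ^ (k + 1) + 2 * g ^ k + t)"
        unfolding f_def using k by (simp add: eval_nat_numeral algebra_simps)
      then show ?thesis using g2 by (simp only: mod_mult_self2 mod_less)
    qed
    have "card B = g ^ k"
      unfolding B_def using assms by (subst card_image) (auto simp: inj_on_def f_def)
    moreover have "?A \<inter> B = {}"
    proof -
      have "False" if "t < g ^ k" "f t = p + q" "palindrome g p" "palindrome g q" for t p q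
        using no_palindrome_sum[OF assms _ _ f_hi[OF that(1)] f_mod that(2-4)] k
        by (simp add: f_def)
      then show ?thesis unfolding B_def by fast
    qed
    moreover have sub: "?A \<union> B \<subseteq> {1..nat \<lfloor>x\<rfloor>}"
    proof -
      have "f t \<ge> 1 \<and> f t \<le> nat \<lfloor>x\<rfloor>" if "t < g ^ k" for t
      proof
        have "g ^ (M - 1) * 3 \<le> g ^ (M - 1) * g" using assms by simp
        also have "\<dots> = g ^ M" using k by (cases M) auto
        finally have "f t \<le> 3 * g ^ M" using f_hi[OF that] by linarith
        then have "real (f t) \<le> 3 * real g ^ M"
          by (metis of_nat_le_iff of_nat_mult of_nat_numeral of_nat_power)
        then show "f t \<le> nat \<lfloor>x\<rfloor>" using x_lo by (simp add: le_nat_floor)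
      qed (simp add: f_def)
      then show ?thesis by (auto simp: B_def le_nat_floor)
    qed
    moreover have "finite ?A" "finite B"
      using finite_subset[OF sub finite_atLeastAtMost] by (simp_all only: finite_Un)
    ultimately have "card (?A \<union> B) = card ?A + g ^ k"
      by (simp only: card_Un_disjoint)
    moreover have "card (?A \<union> B) \<le> nat \<lfloor>x\<rfloor>"
      using card_mono[OF finite_atLeastAtMost sub] by (simp only: card_atLeastAtMost diff_Suc_1)
    ultimately have "card ?A + g ^ k \<le> nat \<lfloor>x\<rfloor>" by linarith
    then have "real (card ?A) + real g ^ k \<le> real (nat \<lfloor>x\<rfloor>)"
      by (simp only: of_nat_le_iff flip: of_nat_add of_nat_power)
    also have "\<dots> \<le> x" using x0 by simp
    finally have "real (card ?A) \<le> x - real g ^ k" by simp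
    also have "\<dots> \<le> x - x / (3 * real g ^ 4)"
    proof -
      have "x \<le> real g ^ k * (3 * real g ^ 4)"
        using x_hi k by (simp add: eval_nat_numeral mult_ac)
      then show ?thesis using assms by (simp add: divide_le_eq)
    qed
    finally show ?case by (simp add: algebra_simps)
  qed
qed

end
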